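(* Write $\Delta(C)=C^{(1)}\otimes C^{(2)}$ in Sweedler's notation and let $\overline C_{13}=C^{(1)}\otimes1\otimes C^{(2)}\in U(\mathfrak{osp}(1|2))^{\otimes3}$. Then the element $$C_{13}=\mathcal R_{32}^{-1}\,\overline C_{13}\,\mathcal R_{32}$$ belongs to the centralizer of $\mathfrak{osp}(1|2)$ in $U(\mathfrak{osp}(1|2))^{\otimes3}$, that is, $[(\Delta\otimes\mathrm{id})\Delta(x),\,C_{13}]=0$ for all $x\in\mathfrak{osp}(1|2)$.
   Context: Work over $\mathbb{C}$. $[X,Y]=XY-YX$ and $\{X,Y\}=XY+YX$. $U(\mathfrak{osp}(1|2))$ denotes the unital associative algebra generated by the generators $F^\pm,H,E^\pm$ of $\mathfrak{osp}(1|2)$ and a grading involution $P$ with relations $[H,E^\pm]=\pm E^\pm$, $[E^+,E^-]=2H$, $[H,F^\pm]=\pm\frac12F^\pm$, $\{F^+,F^-\}=\frac12H$, $[E^\pm,F^\mp]=-F^\pm$, $\{F^\pm,F^\pm\}=\pm\frac12E^\pm$, $[P,E^\pm]=0$, $[P,H]=0$, $\{P,F^\pm\}=0$, $P^2=1$. Tensor powers carry the ordinary (ungraded) componentwise product. The coproduct $\Delta$ is the (coassociative) algebra homomorphism with $\Delta(E^\pm)=E^\pm\otimes1+1\otimes E^\pm$, $\Delta(H)=H\otimes1+1\otimes H$, $\Delta(F^\pm)=F^\pm\otimes P+1\otimes F^\pm$, $\Delta(P)=P\otimes P$. The Casimir element is $C=8[F^+,F^-]P+P$, which is central in $U(\mathfrak{osp}(1|2))$.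 The universal $R$-matrix is $\mathcal R=\frac12(1\otimes1+P\otimes1+1\otimes P-P\otimes P)$, with $\mathcal R^{-1}=\mathcal R$; $\mathcal R_{ij}$ denotes $\mathcal R$ with its first leg in factor $i$ and second leg in factor $j$ of the tensor product. *)

theory Defs
  imports Complex_Main "HOL-Library.Poly_Mapping"
begin

section \<open>Complex vector spaces and unital associative complex algebras\<close>

class cvec = ab_group_add +
  fixes scaleC :: "complex \<Rightarrow> 'a \<Rightarrow> 'a" (infixr "*\<^sub>C" 75)
  assumes scaleC_add_right: "c *\<^sub>C (x + y) = c *\<^sub>C x + c *\<^sub>C y"
    and scaleC_add_left: "(c + d) *\<^sub>C x = c *\<^sub>C x + d *\<^sub>C x"
    and scaleC_scaleC: "c *\<^sub>C d *\<^sub>C x = (c * d) *\<^sub>C x"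
    and scaleC_one: "1 *\<^sub>C x = x"

class calg = cvec + ring_1 +
  assumes mult_scaleC_left: "(c *\<^sub>C x) * y = c *\<^sub>C (x * y)"
    and mult_scaleC_right: "x * (c *\<^sub>C y) = c *\<^sub>C (x * y)"

global_interpretation cvec: vector_space "scaleC :: complex \<Rightarrow> 'a \<Rightarrow> 'a::cvec"
  by unfold_locales (simp_all add: scaleC_add_right scaleC_add_left scaleC_scaleC scaleC_one)

instantiation complex :: calg
begin
definition scaleC_complex :: "complex \<Rightarrow> complex \<Rightarrow> complex"
  where scaleC_complex_def [simp]: "scaleC_complex c x = c * x"
instance by standard (simp_all add: algebra_simps)
end

abbreviation clinear :: "('a::cvec \<Rightarrow> 'b::cvec) \<Rightarrow> bool"
  where "clinear \<equiv> Vector_Spaces.linear scaleC scaleC"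

lemma clinearI:
  assumes "\<And>x y. f (x + y) = f x + f y" "\<And>c x. f (c *\<^sub>C x) = c *\<^sub>C f x"
  shows "clinear f"
  by (simp add: Vector_Spaces.linear_def module_hom_axioms_def module_hom_def assms
      cvec.vector_space_axioms cvec.module_axioms)

lemma clinear_add: "clinear f \<Longrightarrow> f (x + y) = f x + f y"
  by (simp add: Vector_Spaces.linear_def module_hom_axioms_def module_hom_def)

lemma clinear_scale: "clinear f \<Longrightarrow> f (c *\<^sub>C x) = c *\<^sub>C f x"
  by (simp add: Vector_Spaces.linear_def module_hom_axioms_def module_hom_def)

lemma clinear_zero: "clinear f \<Longrightarrow> f 0 = 0"
  using clinear_add[of f 0 0] by simp

lemma clinear_uminus: "clinear f \<Longrightarrow> f (- x) = - f x"
  using clinear_add[of f x "- x"] clinear_zero[of f] by (simp add: eq_neg_iff_add_eq_0 add.commute)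

lemma clinear_diff: "clinear f \<Longrightarrow> f (x - y) = f x - f y"
  using clinear_add[of f x "- y"] clinear_uminus[of f y] by simp

lemmas clinear_simps = clinear_add clinear_scale clinear_zero clinear_uminus clinear_diff

lemma clinear_id: "clinear (\<lambda>x. x)"
  by (rule clinearI) auto

definition commutator :: "'a::ring \<Rightarrow> 'a \<Rightarrow> 'a"
  where "commutator x y = x * y - y * x"

definition anticommutator :: "'a::ring \<Rightarrow> 'a \<Rightarrow> 'a"
  where "anticommutator x y = x * y + y * x"

text \<open>The two-sided multiplicative inverse; only meaningful for units.\<close>

definition unit_inverse :: "'a::monoid_mult \<Rightarrow> 'a"
  where "unit_inverse x = (THE y. x * y = 1 \<and> y * x = 1)"

lemma unit_inverse_eq:
  assumes "x * y = 1" "y * x = 1"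
  shows "unit_inverse x = y"
  unfolding unit_inverse_def
proof (rule the_equality)
  fix z assume "x * z = 1 \<and> z * x = 1"
  then show "z = y" using assms by (metis mult.assoc mult_1_left mult_1_right)
qed (use assms in simp)


section \<open>Free vector spaces\<close>

instantiation poly_mapping :: (type, cvec) cvec
begin

definition scaleC_poly_mapping :: "complex \<Rightarrow> ('a \<Rightarrow>\<^sub>0 'b) \<Rightarrow> 'a \<Rightarrow>\<^sub>0 'b"
  where "scaleC_poly_mapping c f = Poly_Mapping.map (scaleC c) f"

lemma lookup_scaleC: "Poly_Mapping.lookup (c *\<^sub>C f) k = c *\<^sub>C Poly_Mapping.lookup (f :: 'a \<Rightarrow>\<^sub>0 'b) k"
  by (simp add: scaleC_poly_mapping_def map.rep_eq when_def)

instance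
  by standard (rule poly_mapping_eqI, simp add: lookup_scaleC lookup_add scaleC_add_right
      scaleC_add_left scaleC_scaleC scaleC_one)+

end

lemma scaleC_single: "c *\<^sub>C Poly_Mapping.single k x = Poly_Mapping.single k (c *\<^sub>C x)"
  by (rule poly_mapping_eqI) (simp add: lookup_scaleC lookup_single when_def)

lemma poly_mapping_additive_induct [case_names zero single add]:
  assumes "P 0" "\<And>k c. P (Poly_Mapping.single k c)" "\<And>f g. P f \<Longrightarrow> P g \<Longrightarrow> P (f + g)"
  shows "P (f :: 'a \<Rightarrow>\<^sub>0 'b::ab_group_add)"
proof -
  have *: "P (\<Sum>k\<in>A. Poly_Mapping.single k (Poly_Mapping.lookup f k))" if "finite A" for A
    using that by induction (auto intro: assms)
  have "f = (\<Sum>k\<in>Poly_Mapping.keys f. Poly_Mapping.single k (Poly_Mapping.lookup f k))"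
    by (rule poly_mapping_eqI)
      (auto simp: lookup_sum lookup_single when_def in_keys_iff)
  then show ?thesis using *[of "Poly_Mapping.keys f"] by (metis finite_keys)
qed

instance poly_mapping :: (monoid_add, calg) calg
proof
  fix c :: complex and f g :: "'a \<Rightarrow>\<^sub>0 'b"
  show "(c *\<^sub>C f) * g = c *\<^sub>C (f * g)"
  proof (induction f rule: poly_mapping_additive_induct)
    case (single k x)
    then show ?case
      by (induction g rule: poly_mapping_additive_induct)
        (auto simp: scaleC_single mult_single mult_scaleC_left scaleC_add_right algebra_simps)
  qed (auto simp: scaleC_add_right algebra_simps)
  show "f * (c *\<^sub>C g) = c *\<^sub>C (f * g)"
  proof (induction f rule: poly_mapping_additive_induct)
    case (single k x)
    then show ?case
      by (induction g rule: poly_mapping_additive_induct)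
        (auto simp: scaleC_single mult_single mult_scaleC_right scaleC_add_right algebra_simps)
  qed (auto simp: scaleC_add_right algebra_simps)
qed

definition linear_extension :: "('k \<Rightarrow> 'v::cvec) \<Rightarrow> ('k \<Rightarrow>\<^sub>0 complex) \<Rightarrow> 'v"
  where "linear_extension h f = (\<Sum>k\<in>Poly_Mapping.keys f. Poly_Mapping.lookup f k *\<^sub>C h k)"

lemma linear_extension_superset:
  "finite A \<Longrightarrow> Poly_Mapping.keys f \<subseteq> A \<Longrightarrow> linear_extension h f = (\<Sum>k\<in>A. Poly_Mapping.lookup f k *\<^sub>C h k)"
  unfolding linear_extension_def
  by (rule sum.mono_neutral_left) (auto simp: in_keys_iff)

lemma clinear_linear_extension: "clinear (linear_extension h)"
proof (rule clinearI)
  fix f g :: "'a \<Rightarrow>\<^sub>0 complex" and c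
  let ?A = "Poly_Mapping.keys f \<union> Poly_Mapping.keys g"
  show "linear_extension h (f + g) = linear_extension h f + linear_extension h g"
    using keys_add[of f g]
    by (simp add: linear_extension_superset[of ?A] lookup_add scaleC_add_left sum.distrib)
  have "Poly_Mapping.keys (c *\<^sub>C f) \<subseteq> Poly_Mapping.keys f"
    by (auto simp: in_keys_iff lookup_scaleC)
  then show "linear_extension h (c *\<^sub>C f) = c *\<^sub>C linear_extension h f"
    by (simp add: linear_extension_superset[of "Poly_Mapping.keys f"] lookup_scaleC cvec.scale_sum_right
        scaleC_scaleC)
qed

lemma linear_extension_single [simp]: "linear_extension h (Poly_Mapping.single k c) = c *\<^sub>C h k"
  by (simp add: linear_extension_def)


section \<open>Free algebras and two-sided ideals\<close>

datatype 'g word = Word "'g list"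

instantiation word :: (type) monoid_add
begin
definition "0 = Word []"
fun plus_word :: "'a word \<Rightarrow> 'a word \<Rightarrow> 'a word" where "Word u + Word v = Word (u @ v)"
instance
proof
  fix a b c :: "'a word"
  show "a + b + c = a + (b + c)" by (cases a; cases b; cases c) simp
  show "0 + a = a" "a + 0 = a" by (cases a; simp add: zero_word_def)+
qed
end

text \<open>
  The monoid operation on words (concatenation) is written additively, so that the convolution
  product of \<open>Poly_Mapping\<close> is the multiplication of the free algebra.
\<close>

type_synonym 'g free_algebra = "'g word \<Rightarrow>\<^sub>0 complex"

definition letter :: "'g \<Rightarrow> 'g free_algebra"
  where "letter g = Poly_Mapping.single (Word [g]) 1"

fun word_eval :: "('g \<Rightarrow> 'a::monoid_mult) \<Rightarrow> 'g word \<Rightarrow> 'a"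
  where "word_eval \<phi> (Word u) = prod_list (map \<phi> u)"

definition alg_eval :: "('g \<Rightarrow> 'a::calg) \<Rightarrow> 'g free_algebra \<Rightarrow> 'a"
  where "alg_eval \<phi> = linear_extension (word_eval \<phi>)"

lemma clinear_alg_eval: "clinear (alg_eval \<phi>)"
  by (simp add: alg_eval_def clinear_linear_extension)

lemmas alg_eval_simps = clinear_simps[OF clinear_alg_eval]

lemma alg_eval_letter: "alg_eval \<phi> (letter g) = \<phi> g"
  by (simp add: alg_eval_def letter_def scaleC_one)

lemma alg_eval_one: "alg_eval \<phi> 1 = 1"
  unfolding alg_eval_def single_one[symmetric] linear_extension_single
  by (simp add: scaleC_one zero_word_def)

lemma word_eval_add: "word_eval \<phi> (u + v) = word_eval \<phi> u * word_eval \<phi> v"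
  by (cases u; cases v) simp

lemma alg_eval_mult: "alg_eval \<phi> (f * g) = alg_eval \<phi> f * alg_eval \<phi> g"
proof (induction f rule: poly_mapping_additive_induct)
  case (single k x)
  then show ?case
    by (induction g rule: poly_mapping_additive_induct)
      (auto simp: alg_eval_def mult_single word_eval_add mult_scaleC_left mult_scaleC_right
        scaleC_scaleC clinear_simps[OF clinear_linear_extension] algebra_simps)
qed (auto simp: alg_eval_simps algebra_simps)

inductive_set two_sided_ideal :: "'a::ring set \<Rightarrow> 'a set" for S where
  generator: "x \<in> S \<Longrightarrow> x \<in> two_sided_ideal S"
| zero: "0 \<in> two_sided_ideal S"
| add: "x \<in> two_sided_ideal S \<Longrightarrow> y \<in> two_sided_ideal S \<Longrightarrow> x + y \<in> two_sided_ideal S"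
| mult_left: "x \<in> two_sided_ideal S \<Longrightarrow> a * x \<in> two_sided_ideal S"
| mult_right: "x \<in> two_sided_ideal S \<Longrightarrow> x * a \<in> two_sided_ideal S"

lemma two_sided_ideal_scaleC:
  fixes S :: "'a::calg set"
  shows "x \<in> two_sided_ideal S \<Longrightarrow> c *\<^sub>C x \<in> two_sided_ideal S"
  using two_sided_ideal.mult_left[of x S "c *\<^sub>C 1"] by (simp add: mult_scaleC_left)

lemma two_sided_ideal_uminus:
  fixes S :: "'a::ring_1 set"
  shows "x \<in> two_sided_ideal S \<Longrightarrow> - x \<in> two_sided_ideal S"
  using two_sided_ideal.mult_left[of x S "- 1"] by simp


section \<open>Tensor products of complex algebras\<close>

definition bilinear_relators :: "('a::cvec \<times> 'b::cvec \<Rightarrow>\<^sub>0 complex) set"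
  where "bilinear_relators =
    (let e = (\<lambda>a b. Poly_Mapping.single (a, b) 1) in
      {e (a + a') b - (e a b + e a' b) |a a' b. True} \<union>
      {e a (b + b') - (e a b + e a b') |a b b'. True} \<union>
      {e (c *\<^sub>C a) b - c *\<^sub>C e a b |c a b. True} \<union>
      {e a (c *\<^sub>C b) - c *\<^sub>C e a b |c a b. True})"

definition tensor_rel :: "('a::cvec \<times> 'b::cvec \<Rightarrow>\<^sub>0 complex) \<Rightarrow> ('a \<times> 'b \<Rightarrow>\<^sub>0 complex) \<Rightarrow> bool"
  where "tensor_rel f g \<longleftrightarrow> f - g \<in> cvec.span bilinear_relators"

quotient_type (overloaded) ('a, 'b) tensor = "('a::cvec \<times> 'b::cvec) \<Rightarrow>\<^sub>0 complex" / tensor_rel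
proof (rule equivpI)
  show "reflp tensor_rel"
    by (simp add: reflp_def tensor_rel_def cvec.span_zero)
  show "symp tensor_rel"
    unfolding symp_def tensor_rel_def using cvec.span_neg by fastforce
  show "transp tensor_rel"
    unfolding transp_def tensor_rel_def using cvec.span_add by fastforce
qed

instantiation tensor :: (cvec, cvec) cvec
begin

lift_definition zero_tensor :: "('a, 'b) tensor" is 0 .

lift_definition plus_tensor :: "('a, 'b) tensor \<Rightarrow> ('a, 'b) tensor \<Rightarrow> ('a, 'b) tensor" is "(+)"
  unfolding tensor_rel_def by (simp only: add_diff_add cvec.span_add)

lift_definition uminus_tensor :: "('a, 'b) tensor \<Rightarrow> ('a, 'b) tensor" is uminus
  unfolding tensor_rel_def by (simp only: minus_diff_minus cvec.span_neg)

lift_definition minus_tensor :: "('a, 'b) tensor \<Rightarrow> ('a, 'b) tensor \<Rightarrow> ('a, 'b) tensor" is "(-)"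
proof -
  fix f g f' g' :: "'a \<times> 'b \<Rightarrow>\<^sub>0 complex"
  have "f - f' - (g - g') = (f - g) - (f' - g')" by simp
  then show "tensor_rel f g \<Longrightarrow> tensor_rel f' g' \<Longrightarrow> tensor_rel (f - f') (g - g')"
    unfolding tensor_rel_def by (simp only: cvec.span_diff)
qed

lift_definition scaleC_tensor :: "complex \<Rightarrow> ('a, 'b) tensor \<Rightarrow> ('a, 'b) tensor" is scaleC
  unfolding tensor_rel_def
  by (simp only: cvec.span_scale cvec.scale_right_diff_distrib[symmetric])

instance
  by standard
    (transfer, simp add: tensor_rel_def cvec.span_zero scaleC_add_right scaleC_add_left
      scaleC_scaleC scaleC_one algebra_simps)+

end

lift_definition tensor_of :: "'a::cvec \<Rightarrow> 'b::cvec \<Rightarrow> ('a, 'b) tensor" (infixl "\<otimes>" 76)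
  is "\<lambda>a b. Poly_Mapping.single (a, b) 1" .

lemma tensor_rel_relator: "f - g \<in> bilinear_relators \<Longrightarrow> tensor_rel f g"
  by (simp add: tensor_rel_def cvec.span_base)

lemma tensor_add_left: "(a + a') \<otimes> b = a \<otimes> b + a' \<otimes> b"
  by transfer (rule tensor_rel_relator, unfold bilinear_relators_def Let_def, blast)

lemma tensor_add_right: "a \<otimes> (b + b') = a \<otimes> b + a \<otimes> b'"
  by transfer (rule tensor_rel_relator, unfold bilinear_relators_def Let_def, blast)

lemma tensor_scale_left: "(c *\<^sub>C a) \<otimes> b = c *\<^sub>C (a \<otimes> b)"
  by transfer (rule tensor_rel_relator, unfold bilinear_relators_def Let_def, blast)

lemma tensor_scale_right: "a \<otimes> (c *\<^sub>C b) = c *\<^sub>C (a \<otimes> b)"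
  by transfer (rule tensor_rel_relator, unfold bilinear_relators_def Let_def, blast)

lemma clinear_tensor_left: "clinear (\<lambda>a. a \<otimes> b)"
  by (rule clinearI) (simp_all add: tensor_add_left tensor_scale_left)

lemma clinear_tensor_right: "clinear (\<lambda>b. a \<otimes> b)"
  by (rule clinearI) (simp_all add: tensor_add_right tensor_scale_right)

lemmas tensor_left_simps = clinear_simps[OF clinear_tensor_left]
lemmas tensor_right_simps = clinear_simps[OF clinear_tensor_right]
lemmas tensor_simps = tensor_left_simps tensor_right_simps

lemma tensor_induct [case_names zero tensor add]:
  fixes x :: "('a::cvec, 'b::cvec) tensor"
  assumes "P 0" "\<And>a b. P (a \<otimes> b)" "\<And>x y. P x \<Longrightarrow> P y \<Longrightarrow> P (x + y)"
  shows "P x"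
proof -
  have *: "P (abs_tensor f)" for f :: "'a \<times> 'b \<Rightarrow>\<^sub>0 complex"
  proof (induction f rule: poly_mapping_additive_induct)
    case zero
    then show ?case using assms(1) by (simp add: zero_tensor_def)
  next
    case (single k c)
    obtain a b where k: "k = (a, b)" by (cases k)
    have "abs_tensor (Poly_Mapping.single k c) = c *\<^sub>C (a \<otimes> b)"
      by (simp add: k tensor_of.abs_eq scaleC_tensor.abs_eq scaleC_single)
    also have "\<dots> = (c *\<^sub>C a) \<otimes> b" by (simp add: tensor_scale_left)
    finally show ?case using assms(2) by simp
  next
    case (add f g)
    then show ?case using assms(3) by (metis plus_tensor.abs_eq)
  qed
  show ?thesis by (induction x rule: tensor.abs_induct) (rule *)
qed

definition bilinear_map :: "('a::cvec \<Rightarrow> 'b::cvec \<Rightarrow> 'c::cvec) \<Rightarrow> bool"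
  where "bilinear_map h \<longleftrightarrow> (\<forall>b. clinear (\<lambda>a. h a b)) \<and> (\<forall>a. clinear (h a))"

lemma bilinear_mapI:
  assumes "\<And>a a' b. h (a + a') b = h a b + h a' b" "\<And>c a b. h (c *\<^sub>C a) b = c *\<^sub>C h a b"
    "\<And>a b b'. h a (b + b') = h a b + h a b'" "\<And>c a b. h a (c *\<^sub>C b) = c *\<^sub>C h a b"
  shows "bilinear_map h"
  unfolding bilinear_map_def by (auto intro!: clinearI simp: assms)

text \<open>
  The linear map on the tensor product induced by \<open>h\<close>. The value does not depend on the chosen
  representative as soon as \<open>h\<close> is bilinear, which is the only case of interest.
\<close>

definition tensor_lift :: "('a::cvec \<Rightarrow> 'b::cvec \<Rightarrow> 'c::cvec) \<Rightarrow> ('a, 'b) tensor \<Rightarrow> 'c"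
  where "tensor_lift h x = linear_extension (case_prod h) (rep_tensor x)"

lemma tensor_lift_abs:
  assumes "bilinear_map h"
  shows "tensor_lift h (abs_tensor f) = linear_extension (case_prod h) f"
proof -
  let ?L = "linear_extension (case_prod h)"
  note L = clinear_simps[OF clinear_linear_extension]
  have h1: "clinear (\<lambda>a. h a b)" and h2: "clinear (h a)" for a b
    using assms by (auto simp: bilinear_map_def)
  have *: "?L r = 0" if "r \<in> cvec.span bilinear_relators" for r
    using that
  proof (induction rule: cvec.span_induct_alt)
    case base
    then show ?case by (simp add: L)
  next
    case (step c x y)
    have "?L x = 0"
      using step(1) unfolding bilinear_relators_def Let_def
      by (auto simp: L scaleC_one clinear_simps[OF h1] clinear_simps[OF h2])
    then show ?case using step by (simp add: L)
  qed
  have "tensor_rel (rep_tensor (abs_tensor f)) f"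
    by (rule rep_abs_rsp_left[OF Quotient3_tensor]) (simp add: tensor_rel_def cvec.span_zero)
  then show ?thesis
    unfolding tensor_lift_def tensor_rel_def
    using *[of "rep_tensor (abs_tensor f) - f"] by (simp add: L)
qed

lemma clinear_tensor_lift:
  assumes "bilinear_map h"
  shows "clinear (tensor_lift h)"
proof (rule clinearI)
  note L = clinear_simps[OF clinear_linear_extension]
  fix x y :: "('a, 'b) tensor" and c
  show "tensor_lift h (x + y) = tensor_lift h x + tensor_lift h y"
    by (induction x rule: tensor.abs_induct, induction y rule: tensor.abs_induct) (simp add: plus_tensor.abs_eq tensor_lift_abs[OF assms] L)
  show "tensor_lift h (c *\<^sub>C x) = c *\<^sub>C tensor_lift h x"
    by (induction x rule: tensor.abs_induct) (simp add: scaleC_tensor.abs_eq tensor_lift_abs[OF assms] L)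
qed

lemma tensor_lift_tensor:
  assumes "bilinear_map h"
  shows "tensor_lift h (a \<otimes> b) = h a b"
  by (simp add: tensor_of.abs_eq tensor_lift_abs[OF assms] scaleC_one)

lemmas tensor_lift_simps = tensor_lift_tensor clinear_simps[OF clinear_tensor_lift]

lemma clinear_functional_one: "\<exists>f :: 'a::calg \<Rightarrow> complex. clinear f \<and> f 1 = 1"
proof -
  interpret vector_space_pair "scaleC :: complex \<Rightarrow> 'a \<Rightarrow> 'a" "scaleC :: complex \<Rightarrow> complex \<Rightarrow> complex"
    by unfold_locales
  have "\<not> cvec.dependent {1 :: 'a}"
    by (simp add: cvec.dependent_single)
  from linear_independent_extend[OF this, of "\<lambda>_. 1"] show ?thesis by auto
qed

definition tensor_left_mult :: "'a::calg \<Rightarrow> 'b::calg \<Rightarrow> ('a, 'b) tensor \<Rightarrow> ('a, 'b) tensor"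
  where "tensor_left_mult a b = tensor_lift (\<lambda>a' b'. (a * a') \<otimes> (b * b'))"

lemma bilinear_tensor_left_mult: "bilinear_map (\<lambda>a' b'. (a * a') \<otimes> (b * b'))"
  for a :: "'a::calg" and b :: "'b::calg"
  by (rule bilinear_mapI) (simp_all add: algebra_simps mult_scaleC_right tensor_simps)

lemmas tensor_left_mult_simps =
  tensor_lift_simps[OF bilinear_tensor_left_mult, folded tensor_left_mult_def]

lemma bilinear_tensor_left_mult2: "bilinear_map (\<lambda>a b. tensor_left_mult a b y)"
proof (rule bilinear_mapI)
  note L = tensor_left_mult_simps
  fix a a' :: 'a and b b' :: 'b and c
  show "tensor_left_mult (a + a') b y = tensor_left_mult a b y + tensor_left_mult a' b y"
    by (induction y rule: tensor_induct) (simp_all add: L distrib_right tensor_simps)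
  show "tensor_left_mult a (b + b') y = tensor_left_mult a b y + tensor_left_mult a b' y"
    by (induction y rule: tensor_induct) (simp_all add: L distrib_right tensor_simps)
  show "tensor_left_mult (c *\<^sub>C a) b y = c *\<^sub>C tensor_left_mult a b y"
    by (induction y rule: tensor_induct)
      (simp_all add: L scaleC_add_right mult_scaleC_left tensor_simps)
  show "tensor_left_mult a (c *\<^sub>C b) y = c *\<^sub>C tensor_left_mult a b y"
    by (induction y rule: tensor_induct)
      (simp_all add: L scaleC_add_right mult_scaleC_left tensor_simps)
qed

instantiation tensor :: (calg, calg) calg
begin

definition one_tensor :: "('a, 'b) tensor"
  where "one_tensor = 1 \<otimes> 1"

definition times_tensor :: "('a, 'b) tensor \<Rightarrow> ('a, 'b) tensor \<Rightarrow> ('a, 'b) tensor"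
  where "times_tensor x y = tensor_lift (\<lambda>a b. tensor_left_mult a b y) x"

lemma tensor_times_left: "((a :: 'a) \<otimes> (b :: 'b)) * y = tensor_left_mult a b y"
  by (simp add: times_tensor_def tensor_lift_simps[OF bilinear_tensor_left_mult2])

lemma tensor_mult [simp]: "((a :: 'a) \<otimes> (b :: 'b)) * (a' \<otimes> b') = (a * a') \<otimes> (b * b')"
  by (simp add: tensor_times_left tensor_left_mult_simps)

lemma tensor_mult_linear_left:
  "(x + y) * z = x * z + y * z" "(c *\<^sub>C x) * y = c *\<^sub>C (x * y)" "0 * x = 0"
  for x y z :: "('a, 'b) tensor"
  by (simp_all add: times_tensor_def tensor_lift_simps[OF bilinear_tensor_left_mult2])

lemma tensor_mult_linear_right:
  "x * (y + z) = x * y + x * z" "x * (c *\<^sub>C y) = c *\<^sub>C (x * y)" "x * 0 = 0"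
  for x y z :: "('a, 'b) tensor"
  by (induction x rule: tensor_induct;
      simp add: tensor_mult_linear_left tensor_times_left tensor_left_mult_simps scaleC_add_right)+

lemmas tensor_mult_linear = tensor_mult_linear_left tensor_mult_linear_right

instance
proof
  fix x y z :: "('a, 'b) tensor" and c
  note T = tensor_mult_linear
  show "x * y * z = x * (y * z)"
  proof (induction x rule: tensor_induct)
    case (tensor a b)
    show ?case
    proof (induction y rule: tensor_induct)
      case (tensor a' b')
      show ?case by (induction z rule: tensor_induct) (simp_all add: T mult.assoc)
    qed (simp_all add: T)
  qed (simp_all add: T)
  show "1 * x = x" "x * 1 = x"
    by (induction x rule: tensor_induct; simp add: T one_tensor_def)+
  show "(0 :: ('a, 'b) tensor) \<noteq> 1"
  proof
    assume eq: "(0 :: ('a, 'b) tensor) = 1"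
    obtain f :: "'a \<Rightarrow> complex" where f: "clinear f" "f 1 = 1" using clinear_functional_one by blast
    obtain g :: "'b \<Rightarrow> complex" where g: "clinear g" "g 1 = 1" using clinear_functional_one by blast
    have "bilinear_map (\<lambda>a b. f a * g b)"
      by (rule bilinear_mapI)
        (simp_all add: clinear_simps[OF f(1)] clinear_simps[OF g(1)] algebra_simps)
    note L = tensor_lift_simps[OF this]
    have "tensor_lift (\<lambda>a b. f a * g b) 1 = 1" by (simp add: one_tensor_def L f g)
    then show False using L(4) eq by simp
  qed
qed (simp_all add: tensor_mult_linear)

end

definition tensor_map ::
  "('a::cvec \<Rightarrow> 'c::cvec) \<Rightarrow> ('b::cvec \<Rightarrow> 'd::cvec) \<Rightarrow> ('a, 'b) tensor \<Rightarrow> ('c, 'd) tensor"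
  where "tensor_map f g = tensor_lift (\<lambda>a b. f a \<otimes> g b)"

text \<open>
  Embeddings of the two-fold into the three-fold tensor power, which is bracketed to the left.
  \<open>leg13\<close> sends the first and second leg to factors 1 and 3, \<open>leg32\<close> to factors 3 and 2.
\<close>

definition leg13 :: "('a::calg, 'a) tensor \<Rightarrow> (('a, 'a) tensor, 'a) tensor"
  where "leg13 = tensor_lift (\<lambda>a b. a \<otimes> 1 \<otimes> b)"

definition leg32 :: "('a::calg, 'a) tensor \<Rightarrow> (('a, 'a) tensor, 'a) tensor"
  where "leg32 = tensor_lift (\<lambda>a b. 1 \<otimes> b \<otimes> a)"

lemma bilinear_tensor_map: "clinear f \<Longrightarrow> clinear g \<Longrightarrow> bilinear_map (\<lambda>a b. f a \<otimes> g b)"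
  by (rule bilinear_mapI) (simp_all add: clinear_simps tensor_simps)

lemma tensor_map_tensor: "clinear f \<Longrightarrow> clinear g \<Longrightarrow> tensor_map f g (a \<otimes> b) = f a \<otimes> g b"
  by (simp add: tensor_map_def tensor_lift_tensor bilinear_tensor_map)

lemma clinear_tensor_map: "clinear f \<Longrightarrow> clinear g \<Longrightarrow> clinear (tensor_map f g)"
  by (simp add: tensor_map_def clinear_tensor_lift bilinear_tensor_map)

lemma bilinear_legs:
  "bilinear_map (\<lambda>(a :: 'a) (b :: 'a::calg). a \<otimes> (1 :: 'a) \<otimes> b)"
  "bilinear_map (\<lambda>(a :: 'a) (b :: 'a::calg). (1 :: 'a) \<otimes> b \<otimes> a)"
  by (rule bilinear_mapI; simp add: tensor_simps)+

lemmas leg13_simps = tensor_lift_simps[OF bilinear_legs(1), folded leg13_def]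
lemmas leg32_simps = tensor_lift_simps[OF bilinear_legs(2), folded leg32_def]


section \<open>The algebra \<open>U(osp(1|2))\<close>\<close>

text \<open>The letters \<open>p\<close> and \<open>m\<close> stand for the superscripts plus and minus.\<close>

datatype osp12_gen = G_Fp | G_Fm | G_H | G_Ep | G_Em | G_P

definition osp12_relations :: "(osp12_gen \<Rightarrow> 'a::calg) \<Rightarrow> ('a \<times> 'a) set"
  where "osp12_relations \<phi> =
    (let Fp = \<phi> G_Fp; Fm = \<phi> G_Fm; H = \<phi> G_H; Ep = \<phi> G_Ep; Em = \<phi> G_Em; P = \<phi> G_P in
      {(commutator H Ep, Ep),
       (commutator H Em, - Em),
       (commutator Ep Em, 2 *\<^sub>C H),
       (commutator H Fp, (1/2) *\<^sub>C Fp),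
       (commutator H Fm, - ((1/2) *\<^sub>C Fm)),
       (anticommutator Fp Fm, (1/2) *\<^sub>C H),
       (commutator Ep Fm, - Fp),
       (commutator Em Fp, - Fm),
       (anticommutator Fp Fp, (1/2) *\<^sub>C Ep),
       (anticommutator Fm Fm, - ((1/2) *\<^sub>C Em)),
       (commutator P Ep, 0),
       (commutator P Em, 0),
       (commutator P H, 0),
       (anticommutator P Fp, 0),
       (anticommutator P Fm, 0),
       (P * P, 1)})"

definition osp12_ideal :: "osp12_gen free_algebra set"
  where "osp12_ideal = two_sided_ideal {l - r |l r. (l, r) \<in> osp12_relations letter}"

definition osp12_rel :: "osp12_gen free_algebra \<Rightarrow> osp12_gen free_algebra \<Rightarrow> bool"
  where "osp12_rel f g \<longleftrightarrow> f - g \<in> osp12_ideal"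

lemma alg_eval_relations:
  assumes "(l, r) \<in> osp12_relations letter"
  shows "(alg_eval \<phi> l, alg_eval \<phi> r) \<in> osp12_relations \<phi>"
proof -
  have "osp12_relations \<phi> = map_prod (alg_eval \<phi>) (alg_eval \<phi>) ` osp12_relations letter"
    unfolding osp12_relations_def Let_def commutator_def anticommutator_def image_insert
      map_prod_simp alg_eval_simps alg_eval_mult alg_eval_letter alg_eval_one image_empty ..
  then show ?thesis using assms by force
qed

lemma alg_eval_ideal:
  assumes \<phi>: "\<And>l r. (l, r) \<in> osp12_relations \<phi> \<Longrightarrow> l = r" and x: "x \<in> osp12_ideal"
  shows "alg_eval \<phi> x = 0"
  using x unfolding osp12_ideal_def
proof induction
  case (generator x)
  then show ?case using \<phi> alg_eval_relations[of _ _ \<phi>] by (auto simp: alg_eval_simps)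
qed (auto simp: alg_eval_simps alg_eval_mult)

quotient_type osp12_U = "osp12_gen free_algebra" / osp12_rel
proof (rule equivpI)
  note I = two_sided_ideal.zero two_sided_ideal_uminus two_sided_ideal.add
  show "reflp osp12_rel"
    by (simp add: reflp_def osp12_rel_def osp12_ideal_def I)
  show "symp osp12_rel"
    unfolding symp_def osp12_rel_def osp12_ideal_def using I(2) by fastforce
  show "transp osp12_rel"
    unfolding transp_def osp12_rel_def osp12_ideal_def using I(3) by fastforce
qed

instantiation osp12_U :: calg
begin

lift_definition zero_osp12_U :: osp12_U is 0 .
lift_definition one_osp12_U :: osp12_U is 1 .

lift_definition plus_osp12_U :: "osp12_U \<Rightarrow> osp12_U \<Rightarrow> osp12_U" is "(+)"
  unfolding osp12_rel_def osp12_ideal_def by (simp only: two_sided_ideal.add add_diff_add)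

lift_definition uminus_osp12_U :: "osp12_U \<Rightarrow> osp12_U" is uminus
  unfolding osp12_rel_def osp12_ideal_def by (simp only: two_sided_ideal_uminus minus_diff_minus)

lift_definition minus_osp12_U :: "osp12_U \<Rightarrow> osp12_U \<Rightarrow> osp12_U" is "(-)"
proof -
  fix f g f' g' :: "osp12_gen free_algebra"
  have "f - f' - (g - g') = (f - g) + - (f' - g')" by simp
  then show "osp12_rel f g \<Longrightarrow> osp12_rel f' g' \<Longrightarrow> osp12_rel (f - f') (g - g')"
    unfolding osp12_rel_def osp12_ideal_def
    by (simp only: two_sided_ideal.add two_sided_ideal_uminus)
qed

lift_definition times_osp12_U :: "osp12_U \<Rightarrow> osp12_U \<Rightarrow> osp12_U" is "(*)"
proof -
  fix f g f' g' :: "osp12_gen free_algebra"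
  have "f * f' - g * g' = (f - g) * f' + g * (f' - g')" by (simp add: algebra_simps)
  then show "osp12_rel f g \<Longrightarrow> osp12_rel f' g' \<Longrightarrow> osp12_rel (f * f') (g * g')"
    unfolding osp12_rel_def osp12_ideal_def
    by (simp only: two_sided_ideal.add two_sided_ideal.mult_left two_sided_ideal.mult_right)
qed

lift_definition scaleC_osp12_U :: "complex \<Rightarrow> osp12_U \<Rightarrow> osp12_U" is scaleC
  unfolding osp12_rel_def osp12_ideal_def
  by (simp only: two_sided_ideal_scaleC cvec.scale_right_diff_distrib[symmetric])

instance
proof
  show "(0 :: osp12_U) \<noteq> 1"
  proof transfer
    let ?\<phi> = "\<lambda>g. if g = G_P then 1 else 0 :: complex"
    have "alg_eval ?\<phi> x = 0" if "x \<in> osp12_ideal" for x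
      by (rule alg_eval_ideal[OF _ that])
        (auto simp: osp12_relations_def Let_def commutator_def anticommutator_def)
    from this[of "0 - 1"] show "\<not> osp12_rel 0 1"
      by (auto simp: osp12_rel_def alg_eval_simps alg_eval_one)
  qed
qed (transfer; simp add: osp12_rel_def osp12_ideal_def two_sided_ideal.zero scaleC_add_right
      scaleC_add_left scaleC_scaleC scaleC_one mult_scaleC_left mult_scaleC_right algebra_simps)+

end

lift_definition U_gen :: "osp12_gen \<Rightarrow> osp12_U" is letter .

abbreviation "U_Fp \<equiv> U_gen G_Fp"
abbreviation "U_Fm \<equiv> U_gen G_Fm"
abbreviation "U_H \<equiv> U_gen G_H"
abbreviation "U_Ep \<equiv> U_gen G_Ep"
abbreviation "U_Em \<equiv> U_gen G_Em"
abbreviation "U_P \<equiv> U_gen G_P"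

lemma U_relations: "\<forall>p\<in>osp12_relations U_gen. fst p = snd p"
proof -
  have rel: "abs_osp12_U l' = abs_osp12_U r'" if "(l', r') \<in> osp12_relations letter" for l' r'
    using that unfolding osp12_U.abs_eq_iff osp12_rel_def osp12_ideal_def
    by (auto intro: two_sided_ideal.generator)
  have "osp12_relations U_gen = map_prod abs_osp12_U abs_osp12_U ` osp12_relations letter"
    unfolding osp12_relations_def Let_def commutator_def anticommutator_def image_insert
      image_empty map_prod_simp U_gen.abs_eq plus_osp12_U.abs_eq minus_osp12_U.abs_eq
      uminus_osp12_U.abs_eq times_osp12_U.abs_eq scaleC_osp12_U.abs_eq zero_osp12_U_def
      one_osp12_U_def ..
  then show ?thesis using rel by force
qed

text \<open>The Lie superalgebra \<open>osp(1|2)\<close> inside its enveloping algebra; it does not contain \<open>P\<close>.\<close>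

definition osp12 :: "osp12_U set"
  where "osp12 = cvec.span {U_Fp, U_Fm, U_H, U_Ep, U_Em}"


section \<open>Coproduct, Casimir element and universal R-matrix\<close>

fun coproduct_gen :: "osp12_gen \<Rightarrow> (osp12_U, osp12_U) tensor" where
  "coproduct_gen G_Fp = U_Fp \<otimes> U_P + 1 \<otimes> U_Fp"
| "coproduct_gen G_Fm = U_Fm \<otimes> U_P + 1 \<otimes> U_Fm"
| "coproduct_gen G_H = U_H \<otimes> 1 + 1 \<otimes> U_H"
| "coproduct_gen G_Ep = U_Ep \<otimes> 1 + 1 \<otimes> U_Ep"
| "coproduct_gen G_Em = U_Em \<otimes> 1 + 1 \<otimes> U_Em"
| "coproduct_gen G_P = U_P \<otimes> U_P"

lemma U_commutators:
  "commutator U_H U_Ep = U_Ep" "commutator U_H U_Em = - U_Em"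
  "commutator U_Ep U_Em = 2 *\<^sub>C U_H"
  "commutator U_H U_Fp = (1/2) *\<^sub>C U_Fp" "commutator U_H U_Fm = - ((1/2) *\<^sub>C U_Fm)"
  "anticommutator U_Fp U_Fm = (1/2) *\<^sub>C U_H"
  "commutator U_Ep U_Fm = - U_Fp" "commutator U_Em U_Fp = - U_Fm"
  "anticommutator U_Fp U_Fp = (1/2) *\<^sub>C U_Ep"
  "anticommutator U_Fm U_Fm = - ((1/2) *\<^sub>C U_Em)"
  "commutator U_P U_Ep = 0" "commutator U_P U_Em = 0" "commutator U_P U_H = 0"
  "anticommutator U_P U_Fp = 0" "anticommutator U_P U_Fm = 0" "U_P * U_P = 1"
  by (insert U_relations[unfolded osp12_relations_def Let_def ball_simps fst_conv snd_conv],
      elim conjE, assumption)+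

lemma coproduct_brackets:
  fixes a b p :: "'a::calg"
  shows "commutator (a \<otimes> 1 + 1 \<otimes> a) (b \<otimes> 1 + 1 \<otimes> b) =
      commutator a b \<otimes> 1 + (1 :: 'a) \<otimes> commutator a b"
    and "commutator (a \<otimes> 1 + 1 \<otimes> a) (b \<otimes> p + 1 \<otimes> b) =
      commutator a b \<otimes> p - b \<otimes> commutator p a + 1 \<otimes> commutator a b"
    and "anticommutator (a \<otimes> p + 1 \<otimes> a) (b \<otimes> p + 1 \<otimes> b) =
      anticommutator a b \<otimes> (p * p) + a \<otimes> anticommutator p b + b \<otimes> anticommutator p a
      + 1 \<otimes> anticommutator a b"
    and "commutator (p \<otimes> p) (a \<otimes> 1 + 1 \<otimes> a) =
      commutator p a \<otimes> p + p \<otimes> commutator p a"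
    and "anticommutator (p \<otimes> p) (a \<otimes> p + 1 \<otimes> a) =
      anticommutator p a \<otimes> (p * p) + p \<otimes> anticommutator p a"
  by (simp_all add: commutator_def anticommutator_def algebra_simps tensor_simps)

lemma coproduct_gen_relations:
  assumes "(l, r) \<in> osp12_relations coproduct_gen"
  shows "l = r"
  using assms unfolding osp12_relations_def Let_def coproduct_gen.simps coproduct_brackets
    U_commutators tensor_mult
  by (auto simp: tensor_simps scaleC_add_right one_tensor_def commutator_def[of 1])

lift_definition coproduct :: "osp12_U \<Rightarrow> (osp12_U, osp12_U) tensor" is "alg_eval coproduct_gen"
proof -
  fix f g
  assume "osp12_rel f g"
  then have "alg_eval coproduct_gen (f - g) = 0"
    unfolding osp12_rel_def using coproduct_gen_relations by (rule alg_eval_ideal[rotated])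
  then show "alg_eval coproduct_gen f = alg_eval coproduct_gen g"
    by (simp add: alg_eval_simps)
qed

lemma coproduct_hom:
  "coproduct (x + y) = coproduct x + coproduct y"
  "coproduct (x * y) = coproduct x * coproduct y"
  "coproduct (c *\<^sub>C x) = c *\<^sub>C coproduct x"
  "coproduct 1 = 1"
  "coproduct (U_gen g) = coproduct_gen g"
  by (transfer, simp add: alg_eval_simps alg_eval_mult alg_eval_one alg_eval_letter)+

definition iterated_coproduct :: "osp12_U \<Rightarrow> ((osp12_U, osp12_U) tensor, osp12_U) tensor"
  where "iterated_coproduct x = tensor_map coproduct id (coproduct x)"

definition casimir :: osp12_U
  where "casimir = (8 *\<^sub>C commutator U_Fp U_Fm) * U_P + U_P"

definition R_matrix :: "(osp12_U, osp12_U) tensor"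
  where "R_matrix = (1/2) *\<^sub>C (1 \<otimes> 1 + U_P \<otimes> 1 + 1 \<otimes> U_P - U_P \<otimes> U_P)"

lemma R_matrix_involution: "R_matrix * R_matrix = 1"
proof -
  let ?X = "1 \<otimes> 1 + U_P \<otimes> 1 + 1 \<otimes> U_P - U_P \<otimes> U_P"
  have "?X * ?X = 1 \<otimes> 1 + 1 \<otimes> 1 + 1 \<otimes> 1 + 1 \<otimes> 1"
    by (simp add: distrib_left distrib_right left_diff_distrib right_diff_distrib U_commutators)
  also have "\<dots> = (1 + 1 + 1 + 1) *\<^sub>C (1 \<otimes> 1)"
    by (simp only: scaleC_add_left scaleC_one)
  finally have "?X * ?X = 4 *\<^sub>C (1 \<otimes> 1)" by simp
  then show ?thesis
    by (simp add: R_matrix_def mult_scaleC_left mult_scaleC_right scaleC_scaleC one_tensor_def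
        scaleC_one)
qed

lemma leg32_mult: "leg32 (x * y) = leg32 x * leg32 y"
proof (induction x rule: tensor_induct)
  case (tensor a b)
  show ?case
    by (induction y rule: tensor_induct) (simp_all add: leg32_simps distrib_left)
qed (simp_all add: leg32_simps distrib_right)

lemma leg13_mult: "leg13 (x * y) = leg13 x * leg13 y"
proof (induction x rule: tensor_induct)
  case (tensor a b)
  show ?case
    by (induction y rule: tensor_induct) (simp_all add: leg13_simps distrib_left)
qed (simp_all add: leg13_simps distrib_right)

lemma leg32_R_matrix_involution: "leg32 R_matrix * leg32 R_matrix = 1"
  by (simp add: leg32_mult[symmetric] R_matrix_involution one_tensor_def leg32_simps)

lemma unit_inverse_leg32_R_matrix: "unit_inverse (leg32 R_matrix) = leg32 R_matrix"
  by (simp add: unit_inverse_eq leg32_R_matrix_involution)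

definition Cbar13 :: "((osp12_U, osp12_U) tensor, osp12_U) tensor"
  where "Cbar13 = leg13 (coproduct casimir)"

definition C13 :: "((osp12_U, osp12_U) tensor, osp12_U) tensor"
  where "C13 = unit_inverse (leg32 R_matrix) * Cbar13 * leg32 R_matrix"

definition osp12_centralizer :: "((osp12_U, osp12_U) tensor, osp12_U) tensor set"
  where "osp12_centralizer = {z. \<forall>x\<in>osp12. commutator (iterated_coproduct x) z = 0}"

end

theory Submission
  imports Defs
begin

text \<open>
  Conjugation by \<open>\<R>\<^sub>3\<^sub>2\<close> multiplies an odd element of one of the factors 2, 3 by
  the \<open>P\<close> of the other. Hence it turns
  \<open>(\<Delta> \<otimes> id)\<Delta>(F) = F \<otimes> P \<otimes> P + 1 \<otimes> F \<otimes> P + 1 \<otimes> 1 \<otimes> F\<close> into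
  \<open>F \<otimes> P \<otimes> P + 1 \<otimes> F \<otimes> 1 + 1 \<otimes> P \<otimes> F\<close>, which is
  \<open>P\<close> in factor 2 times \<open>\<Delta>(F)\<close> in factors 1 and 3, plus \<open>F\<close> in factor 2. Both summands commute
  with \<open>\<Delta>(C)\<close> in factors 1 and 3 because \<open>C\<close> is central. This settles \<open>F\<^sup>+\<close> and \<open>F\<^sup>-\<close>, which
  generate \<open>osp(1|2)\<close>.
\<close>

lemma clinear_coproduct: "clinear coproduct"
  by (rule clinearI) (simp_all add: coproduct_hom)

lemma tensor_map_mult:
  assumes f: "clinear f" "\<And>x y. f (x * y) = f x * f y"
    and g: "clinear g" "\<And>x y. g (x * y) = g x * g y"
  shows "tensor_map f g (x * y) = tensor_map f g x * tensor_map f g y"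
proof -
  note L = clinear_simps[OF clinear_tensor_map[OF f(1) g(1)]] tensor_map_tensor[OF f(1) g(1)]
  show ?thesis
  proof (induction x rule: tensor_induct)
    case (tensor a b)
    show ?case
      by (induction y rule: tensor_induct) (simp_all add: L f(2) g(2) distrib_left)
  qed (simp_all add: L distrib_right)
qed

text \<open>Multiplicativity makes commuting with \<open>C13\<close> pass to products, so elements
  generated by \<open>U_Fp\<close> and \<open>U_Fm\<close> are covered once these two are.\<close>

lemma iterated_coproduct_hom:
  "iterated_coproduct (x + y) = iterated_coproduct x + iterated_coproduct y"
  "iterated_coproduct (x * y) = iterated_coproduct x * iterated_coproduct y"
  "iterated_coproduct (c *\<^sub>C x) = c *\<^sub>C iterated_coproduct x"
proof -
  have id: "clinear id" using clinear_id by (simp add: id_def)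
  note L = clinear_simps[OF clinear_tensor_map[OF clinear_coproduct id]]
  show "iterated_coproduct (x + y) = iterated_coproduct x + iterated_coproduct y"
    "iterated_coproduct (c *\<^sub>C x) = c *\<^sub>C iterated_coproduct x"
    by (simp_all add: iterated_coproduct_def coproduct_hom L)
  show "iterated_coproduct (x * y) = iterated_coproduct x * iterated_coproduct y"
    by (simp add: iterated_coproduct_def coproduct_hom tensor_map_mult clinear_coproduct id)
qed

lemma iterated_coproduct_eq:
  assumes "coproduct x = x \<otimes> U_P + 1 \<otimes> x"
  shows "iterated_coproduct x = x \<otimes> U_P \<otimes> U_P + 1 \<otimes> x \<otimes> U_P + 1 \<otimes> 1 \<otimes> x"
proof -
  have id: "clinear id" using clinear_id by (simp add: id_def)
  note L = clinear_simps[OF clinear_tensor_map[OF clinear_coproduct id]]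
  show ?thesis
    by (simp add: iterated_coproduct_def assms L tensor_map_tensor clinear_coproduct id
        coproduct_hom one_tensor_def tensor_simps)
qed

lemma scaleC_two: "2 *\<^sub>C x = x + x" for x :: "'a::cvec"
  using scaleC_add_left[of 1 1 x] by (simp add: scaleC_one)

text \<open>Together with \<open>U_H_eq\<close>, this writes the even generators as quadratic
  expressions in the odd ones.\<close>

lemma odd_squares: "U_Ep = 4 *\<^sub>C (U_Fp * U_Fp)" "U_Em = (-4) *\<^sub>C (U_Fm * U_Fm)"
proof -
  have "U_Ep = 2 *\<^sub>C (1/2) *\<^sub>C U_Ep" by (simp add: scaleC_scaleC scaleC_one)
  also have "\<dots> = 2 *\<^sub>C 2 *\<^sub>C (U_Fp * U_Fp)"
    by (simp only: U_commutators(9)[symmetric] anticommutator_def scaleC_two[symmetric])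
  finally show "U_Ep = 4 *\<^sub>C (U_Fp * U_Fp)" by (simp add: scaleC_scaleC)
  have "U_Em = (-2) *\<^sub>C - ((1/2) *\<^sub>C U_Em)"
    by (simp add: scaleC_scaleC scaleC_one)
  also have "\<dots> = (-2) *\<^sub>C 2 *\<^sub>C (U_Fm * U_Fm)"
    by (simp only: U_commutators(10)[symmetric] anticommutator_def scaleC_two[symmetric])
  finally show "U_Em = (-4) *\<^sub>C (U_Fm * U_Fm)" by (simp add: scaleC_scaleC)
qed

lemma U_H_eq: "U_H = 2 *\<^sub>C (U_Fp * U_Fm + U_Fm * U_Fp)"
  using U_commutators(6) by (simp add: anticommutator_def scaleC_scaleC scaleC_one)

text \<open>Since \<open>U_P\<close> anticommutes with F, the terms of type FF'F cancel in FC - CF,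
  where F' is the opposite odd generator. What remains is (8[FF, F'] + 2F)P for F =
  \<open>U_Fp\<close> and (2F - 8[FF, F'])P for F = \<open>U_Fm\<close>. As FF is a multiple of E,
  the relations for [E, F'] make both vanish.\<close>

lemma commute_odd_casimir:
  "U_Fp * casimir = casimir * U_Fp" "U_Fm * casimir = casimir * U_Fm"
proof -
  have p: "U_P * U_Fp = - (U_Fp * U_P)" "U_P * U_Fm = - (U_Fm * U_P)"
    using U_commutators(14,15) by (simp_all add: anticommutator_def eq_neg_iff_add_eq_0)
  have "8 *\<^sub>C commutator (U_Fp * U_Fp) U_Fm = 2 *\<^sub>C commutator U_Ep U_Fm"
    by (simp add: odd_squares commutator_def mult_scaleC_left mult_scaleC_right scaleC_scaleC
        cvec.scale_right_diff_distrib)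
  then have *: "8 *\<^sub>C (U_Fp * U_Fp * U_Fm) - 8 *\<^sub>C (U_Fm * U_Fp * U_Fp) = - (U_Fp + U_Fp)"
    by (simp add: U_commutators(7,8) scaleC_two)
       (simp add: commutator_def cvec.scale_right_diff_distrib mult.assoc)
  have "U_Fp * casimir - casimir * U_Fp =
      (8 *\<^sub>C (U_Fp * U_Fp * U_Fm) - 8 *\<^sub>C (U_Fm * U_Fp * U_Fp) + (U_Fp + U_Fp)) * U_P"
    by (simp add: casimir_def commutator_def p mult_scaleC_left mult_scaleC_right
        cvec.scale_right_diff_distrib algebra_simps)
  then show "U_Fp * casimir = casimir * U_Fp" unfolding * by simp
  have "8 *\<^sub>C commutator (U_Fm * U_Fm) U_Fp = (-2) *\<^sub>C commutator U_Em U_Fp"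
    by (simp add: odd_squares commutator_def mult_scaleC_left mult_scaleC_right scaleC_scaleC
        cvec.scale_right_diff_distrib)
  then have *: "8 *\<^sub>C (U_Fm * U_Fm * U_Fp) - 8 *\<^sub>C (U_Fp * U_Fm * U_Fm) = U_Fm + U_Fm"
    by (simp add: U_commutators(7,8) scaleC_two)
       (simp add: commutator_def cvec.scale_right_diff_distrib mult.assoc)
  have "U_Fm * casimir - casimir * U_Fm =
      (U_Fm + U_Fm - (8 *\<^sub>C (U_Fm * U_Fm * U_Fp) - 8 *\<^sub>C (U_Fp * U_Fm * U_Fm))) * U_P"
    by (simp add: casimir_def commutator_def p mult_scaleC_left mult_scaleC_right
        cvec.scale_right_diff_distrib algebra_simps)
  then show "U_Fm * casimir = casimir * U_Fm" unfolding * by simp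
qed

text \<open>\<open>R_matrix\<close> is the sign that equals -1 exactly where \<open>U_P\<close> is
  -1 in both legs. An odd element flips \<open>U_P\<close> in its own leg, so passing it through
  costs the \<open>U_P\<close> of the other leg.\<close>

lemma R_matrix_intertwines:
  assumes "anticommutator U_P x = 0"
  shows "R_matrix * (x \<otimes> 1) = (x \<otimes> U_P) * R_matrix"
    and "R_matrix * (U_P \<otimes> x) = (1 \<otimes> x) * R_matrix"
    and "R_matrix * (U_P \<otimes> U_P) = (U_P \<otimes> U_P) * R_matrix"
proof -
  have p: "U_P * x = - (x * U_P)"
    using assms by (simp add: anticommutator_def eq_neg_iff_add_eq_0)
  show "R_matrix * (x \<otimes> 1) = (x \<otimes> U_P) * R_matrix"
    "R_matrix * (U_P \<otimes> x) = (1 \<otimes> x) * R_matrix"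
    "R_matrix * (U_P \<otimes> U_P) = (U_P \<otimes> U_P) * R_matrix"
    by (simp_all add: R_matrix_def mult_scaleC_left mult_scaleC_right distrib_left distrib_right
        left_diff_distrib right_diff_distrib U_commutators p tensor_simps)
qed

lemma leg32_commute: "leg32 y * (a \<otimes> 1 \<otimes> 1) = (a \<otimes> 1 \<otimes> 1) * leg32 y"
  by (induction y rule: tensor_induct) (simp_all add: leg32_simps distrib_left distrib_right)

lemma leg13_commute: "leg13 y * (1 \<otimes> b \<otimes> 1) = (1 \<otimes> b \<otimes> 1) * leg13 y"
  by (induction y rule: tensor_induct) (simp_all add: leg13_simps distrib_left distrib_right)

lemma commuting_mult:
  "x * z = z * x \<Longrightarrow> y * z = z * y \<Longrightarrow> (x * y) * z = z * (x * y)"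
  for x :: "'a::semigroup_mult"
  by (simp add: mult.assoc) (simp add: mult.assoc[symmetric])

lemma iterated_coproduct_commute_C13:
  assumes odd: "anticommutator U_P x = 0" and cop: "coproduct x = x \<otimes> U_P + 1 \<otimes> x"
    and central: "x * casimir = casimir * x"
  shows "iterated_coproduct x * C13 = C13 * iterated_coproduct x"
proof -
  define R where "R = leg32 R_matrix"
  \<comment> \<open>\<open>D\<close> is the conjugate of the iterated coproduct by \<open>R\<close>;
    this form of it exhibits the commutation with \<open>Cbar13\<close>.\<close>
  define D where "D = (1 \<otimes> U_P \<otimes> 1) * leg13 (coproduct x) + 1 \<otimes> x \<otimes> 1"
  have RR: "R * R = 1" by (simp add: R_def leg32_R_matrix_involution)
  have it: "iterated_coproduct x =
      (x \<otimes> 1 \<otimes> 1) * leg32 (U_P \<otimes> U_P) + leg32 (U_P \<otimes> x) + leg32 (x \<otimes> 1)"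
    by (simp add: iterated_coproduct_eq[OF cop] leg32_simps)
  have D: "D = (x \<otimes> 1 \<otimes> 1) * leg32 (U_P \<otimes> U_P) + leg32 (1 \<otimes> x) + leg32 (x \<otimes> U_P)"
    by (simp add: D_def cop leg13_simps leg32_simps distrib_left)
  \<comment> \<open>\<open>R\<close> lives in factors 3 and 2 only, so it passes the entry
    \<open>x\<close> in factor 1.\<close>
  have "R * ((x \<otimes> 1 \<otimes> 1) * leg32 (U_P \<otimes> U_P)) = (x \<otimes> 1 \<otimes> 1) * leg32 (R_matrix * (U_P \<otimes> U_P))"
    by (simp only: R_def leg32_mult mult.assoc[symmetric] leg32_commute)
  then have RI: "R * iterated_coproduct x = D * R"
    by (simp only: it D distrib_left distrib_right R_matrix_intertwines[OF odd]
        leg32_mult[symmetric] R_def mult.assoc)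
  \<comment> \<open>Multiply \<open>RI\<close> by \<open>R\<close> on both sides; \<open>R\<close>
    is its own inverse.\<close>
  have DR: "iterated_coproduct x * R = R * D"
  proof -
    have "iterated_coproduct x * R = R * (R * iterated_coproduct x) * R"
      by (simp add: mult.assoc[symmetric] RR)
    also have "\<dots> = R * D * (R * R)" unfolding RI by (simp add: mult.assoc)
    finally show ?thesis by (simp add: RR)
  qed
  \<comment> \<open>Both sides are images under the multiplicative map \<open>leg13\<close> of the
    coproduct of \<open>x * casimir = casimir * x\<close>.\<close>
  have "leg13 (coproduct x) * Cbar13 = Cbar13 * leg13 (coproduct x)"
    by (simp add: Cbar13_def leg13_mult[symmetric] coproduct_hom(2)[symmetric] central)
  moreover have "(1 \<otimes> b \<otimes> 1) * Cbar13 = Cbar13 * (1 \<otimes> b \<otimes> 1)" for b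
    by (simp add: Cbar13_def leg13_commute)
  ultimately have DC: "D * Cbar13 = Cbar13 * D"
    unfolding D_def distrib_left distrib_right by (intro arg_cong2[where f = plus] commuting_mult)
  have C: "C13 = R * Cbar13 * R" by (simp add: C13_def unit_inverse_leg32_R_matrix R_def)
  have "iterated_coproduct x * C13 = (iterated_coproduct x * R) * Cbar13 * R"
    by (simp add: C mult.assoc)
  also have "\<dots> = R * (D * Cbar13) * R" by (simp only: DR) (simp only: mult.assoc)
  also have "\<dots> = R * Cbar13 * (D * R)" by (simp only: DC) (simp only: mult.assoc)
  also have "\<dots> = C13 * iterated_coproduct x"
    by (simp only: RI[symmetric]) (simp only: C mult.assoc)
  finally show ?thesis .
qed

theorem proposition3p1:
  shows "C13 \<in> osp12_centralizer"
proof -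
  \<comment> \<open>\<open>osp12\<close> is only a linear span, but \<open>S\<close> must also be
    closed under products in order to reach \<open>U_H\<close>, \<open>U_Ep\<close> and
    \<open>U_Em\<close> from \<open>U_Fp\<close> and \<open>U_Fm\<close>.\<close>
  define S where "S = {x. iterated_coproduct x * C13 = C13 * iterated_coproduct x}"
  have add: "x + y \<in> S" if "x \<in> S" "y \<in> S" for x y
    using that by (simp add: S_def iterated_coproduct_hom distrib_left distrib_right)
  have scale: "c *\<^sub>C x \<in> S" if "x \<in> S" for c x
    using that by (simp add: S_def iterated_coproduct_hom mult_scaleC_left mult_scaleC_right)
  have mult: "x * y \<in> S" if "x \<in> S" "y \<in> S" for x y
    using that unfolding S_def mem_Collect_eq iterated_coproduct_hom by (intro commuting_mult)
  have F: "U_Fp \<in> S" "U_Fm \<in> S"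
    unfolding S_def mem_Collect_eq
    by (rule iterated_coproduct_commute_C13;
        simp add: U_commutators coproduct_hom commute_odd_casimir)+
  have gens: "{U_Fp, U_Fm, U_H, U_Ep, U_Em} \<subseteq> S"
    unfolding U_H_eq odd_squares by (intro insert_subsetI empty_subsetI add scale mult F)
  have "x \<in> S" if "x \<in> osp12" for x
    using that unfolding osp12_def
  proof (induction rule: cvec.span_induct_alt)
    \<comment> \<open>The zero vector is obtained as \<open>0 *\<^sub>C U_Fp\<close>.\<close>
    case base
    show ?case using scale[OF F(1), of 0] by simp
  next
    case (step c x y)
    then show ?case using gens add scale by blast
  qed
  then show ?thesis by (simp add: osp12_centralizer_def S_def commutator_def)
qed

end
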